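(* Let $M$ be a partition matroid on a finite ground set $E$. Then there exists a total order $\preceq^\ast$ on $E$ such that the width of each of the BDDs $\mathsf{B}(\mathcal{I}(M))$, $\mathsf{B}(\mathcal{B}(M))$ and ZDDs $\mathsf{Z}(\mathcal{I}(M))$, $\mathsf{Z}(\mathcal{B}(M))$ with respect to $(E,\preceq^\ast)$ is at most $\mathrm{pw}(M)+1$.
   Context: $\mathcal{I}(M)$, $\mathcal{B}(M)$ are the collections of independent sets and bases. A partition matroid is a direct sum of uniform matroids (a uniform matroid of rank $r$ has as independent sets the subsets of size at most $r$; the direct sum of matroids on disjoint ground sets has independent sets $I_1\cup I_2$ with $I_j$ independent in the $j$-th summand). $r_M$ is the rank function, $\lambda_M(X)=r_M(X)+r_M(E\setminus X)-r_M(E)$, and the pathwidth is $\mathrm{pw}(M)=\min_{\preceq}\max_{i\in\{1,\ldots,n\}}\lambda_M(\{e_1,\ldots,e_i\})$, the minimum over total orders $\preceq$ on $E$ written as $e_1\prec\cdots\prec e_n$. Decision diagrams: for a total order $\preceq$ on $E$ and $\mathcal{S}\subseteq 2^E$, the BDD $\mathsf{B}(\mathcal{S})$ (resp. ZDD $\mathsf{Z}(\mathcal{S})$) is the directed acyclic graph obtained from the complete binary decision tree of $\mathcal{S}$ (internal nodes at depth $j$ labeled by the $(j+1)$-th smallest element of $E$, each with a 0-arc to $\nu_0$ and a 1-arc to $\nu_1$; the leaf reached by taking 1-arcs exactly at the elements of $X$ is the terminal $\top$ iff $X\in\mathcal{S}$, else $\bot$) by exhaustively applying: (NS) merge non-terminal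 nodes with the same label, same 0-successor and same 1-successor; and for BDDs remove every non-terminal $\nu$ with $\nu_0=\nu_1$, for ZDDs remove every non-terminal $\nu$ with $\nu_1=\bot$, redirecting arcs entering $\nu$ to $\nu_0$. If $e_1\prec\cdots\prec e_n$, the $i$-th width ($i\in\{0,\ldots,n-1\}$) is the number of non-terminal nodes labeled $e_{i+1}$, and the width is the maximum of these. *)

theory Defs
  imports Main "HOL-Combinatorics.Multiset_Permutations"
begin

section \<open>Matroids\<close>

record 'a matroid =
  ground :: "'a set"
  indeps :: "'a set set"

definition is_matroid :: "'a matroid \<Rightarrow> bool" where
  "is_matroid M \<longleftrightarrow>
     finite (ground M) \<and> indeps M \<subseteq> Pow (ground M) \<and> {} \<in> indeps M \<and>
     (\<forall>X \<in> indeps M. \<forall>Y. Y \<subseteq> X \<longrightarrow> Y \<in> indeps M) \<and>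
     (\<forall>X \<in> indeps M. \<forall>Y \<in> indeps M. card X < card Y \<longrightarrow> (\<exists>y \<in> Y - X. insert y X \<in> indeps M))"

definition bases :: "'a matroid \<Rightarrow> 'a set set" where
  "bases M = {B \<in> indeps M. \<forall>X \<in> indeps M. B \<subseteq> X \<longrightarrow> X = B}"

definition matroid_rank :: "'a matroid \<Rightarrow> 'a set \<Rightarrow> nat" where
  "matroid_rank M X = Max (card ` {I \<in> indeps M. I \<subseteq> X})"

definition connectivity :: "'a matroid \<Rightarrow> 'a set \<Rightarrow> int" where
  "connectivity M X =
     int (matroid_rank M X) + int (matroid_rank M (ground M - X)) - int (matroid_rank M (ground M))"

text \<open>
  A total order \<open>e\<^sub>1 \<prec> \<dots> \<prec> e\<^sub>n\<close> on a finite set \<open>E\<close> is represented by the list \<open>[e\<^sub>1, \<dots>, e\<^sub>n]\<close>,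
  i.e. by an element of \<^term>\<open>permutations_of_set E\<close>.
  The element \<open>0\<close> is inserted only to give the maximum over the empty set the value \<open>0\<close>
  when the ground set is empty; the other values are never negative.
\<close>

definition order_pathwidth :: "'a matroid \<Rightarrow> 'a list \<Rightarrow> int" where
  "order_pathwidth M es =
     Max (insert 0 ((\<lambda>i. connectivity M (set (take i es))) ` {1..length es}))"

definition pathwidth :: "'a matroid \<Rightarrow> int" where
  "pathwidth M = Min (order_pathwidth M ` permutations_of_set (ground M))"

definition uniform_matroid :: "'a set \<Rightarrow> nat \<Rightarrow> 'a matroid" where
  "uniform_matroid E r = \<lparr>ground = E, indeps = {X. X \<subseteq> E \<and> card X \<le> r}\<rparr>"

definition direct_sum :: "'a matroid \<Rightarrow> 'a matroid \<Rightarrow> 'a matroid" where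
  "direct_sum M N =
     \<lparr>ground = ground M \<union> ground N, indeps = {X \<union> Y | X Y. X \<in> indeps M \<and> Y \<in> indeps N}\<rparr>"

inductive partition_matroid :: "'a matroid \<Rightarrow> bool" where
  uniform: "finite E \<Longrightarrow> r \<le> card E \<Longrightarrow> partition_matroid (uniform_matroid E r)"
| sum: "partition_matroid M \<Longrightarrow> partition_matroid N \<Longrightarrow> ground M \<inter> ground N = {} \<Longrightarrow>
    partition_matroid (direct_sum M N)"

lemma is_matroid_uniform:
  assumes "finite E"
  shows "is_matroid (uniform_matroid E r)"
proof -
  have aug: "\<exists>y\<in>Y - X. insert y X \<subseteq> E \<and> card (insert y X) \<le> r"
    if "X \<subseteq> E" "card X \<le> r" "Y \<subseteq> E" "card Y \<le> r" "card X < card Y" for X Y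
  proof -
    have fin: "finite X" "finite Y" using that(1,3) assms finite_subset by blast+
    have "\<not> Y \<subseteq> X" using that(5) card_mono[OF fin(1)] by (meson leD)
    then obtain y where y: "y \<in> Y" "y \<notin> X" by blast
    then have "card (insert y X) \<le> r" using fin that(4,5) by simp
    then show ?thesis using y that(1,3) by blast
  qed
  have her: "card Y \<le> r" if "X \<subseteq> E" "card X \<le> r" "Y \<subseteq> X" for X Y
    using that assms by (meson card_mono finite_subset order_trans)
  let ?I = "{X. X \<subseteq> E \<and> card X \<le> r}"
  have "\<forall>X \<in> ?I. \<forall>Y \<in> ?I. card X < card Y \<longrightarrow> (\<exists>y \<in> Y - X. insert y X \<in> ?I)"
    using aug by simp
  moreover have "\<forall>X \<in> ?I. \<forall>Y. Y \<subseteq> X \<longrightarrow> Y \<in> ?I"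
    using her by (blast intro: subset_trans)
  moreover have "{} \<in> ?I" "?I \<subseteq> Pow E" by auto
  ultimately show ?thesis
    using assms by (simp only: is_matroid_def uniform_matroid_def matroid.simps simp_thms)
qed

lemma is_matroid_direct_sum:
  assumes M: "is_matroid M" and N: "is_matroid N" and disj: "ground M \<inter> ground N = {}"
  shows "is_matroid (direct_sum M N)"
proof -
  let ?I = "{X \<union> Y | X Y. X \<in> indeps M \<and> Y \<in> indeps N}"
  have sub: "X \<subseteq> ground M" "finite X" if "X \<in> indeps M" for X
    using M that unfolding is_matroid_def by (meson PowD finite_subset subsetD)+
  have sub': "X \<subseteq> ground N" "finite X" if "X \<in> indeps N" for X
    using N that unfolding is_matroid_def by (meson PowD finite_subset subsetD)+
  have augM: "\<exists>y \<in> Y - X. insert y X \<in> indeps M"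
    if "X \<in> indeps M" "Y \<in> indeps M" "card X < card Y" for X Y
    using M that by (simp add: is_matroid_def)
  have augN: "\<exists>y \<in> Y - X. insert y X \<in> indeps N"
    if "X \<in> indeps N" "Y \<in> indeps N" "card X < card Y" for X Y
    using N that by (simp add: is_matroid_def)
  have herM: "Y \<in> indeps M" if "X \<in> indeps M" "Y \<subseteq> X" for X Y
    using M that by (simp add: is_matroid_def)
  have herN: "Y \<in> indeps N" if "X \<in> indeps N" "Y \<subseteq> X" for X Y
    using N that by (simp add: is_matroid_def)
  have dj: "X \<inter> Y = {}" if "X \<in> indeps M" "Y \<in> indeps N" for X Y
    using sub(1)[OF that(1)] sub'(1)[OF that(2)] disj by blast
  have "\<exists>y \<in> Y - X. insert y X \<in> ?I"
    if XY: "X \<in> ?I" "Y \<in> ?I" "card X < card Y" for X Y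
  proof -
    obtain A B where AB: "X = A \<union> B" "A \<in> indeps M" "B \<in> indeps N"
      using XY(1) by auto
    obtain C D where CD: "Y = C \<union> D" "C \<in> indeps M" "D \<in> indeps N"
      using XY(2) by auto
    have "card X = card A + card B"
      unfolding AB(1)
      by (rule card_Un_disjoint[OF sub(2)[OF AB(2)] sub'(2)[OF AB(3)] dj[OF AB(2,3)]])
    moreover have "card Y = card C + card D"
      unfolding CD(1)
      by (rule card_Un_disjoint[OF sub(2)[OF CD(2)] sub'(2)[OF CD(3)] dj[OF CD(2,3)]])
    ultimately consider "card A < card C" | "card B < card D" using XY(3) by linarith
    then show ?thesis
    proof cases
      case 1
      then obtain y where y: "y \<in> C - A" "insert y A \<in> indeps M"
        using augM[OF AB(2) CD(2)] by blast
      have "insert y X = insert y A \<union> B" using AB(1) by blast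
      then have "insert y X \<in> ?I" using y AB by blast
      moreover have "y \<in> Y - X"
        using y dj[OF CD(2) AB(3)] unfolding AB(1) CD(1) by blast
      ultimately show ?thesis by blast
    next
      case 2
      then obtain y where y: "y \<in> D - B" "insert y B \<in> indeps N"
        using augN[OF AB(3) CD(3)] by blast
      have "insert y X = A \<union> insert y B" using AB(1) by blast
      then have "insert y X \<in> ?I" using y AB by blast
      moreover have "y \<in> Y - X"
        using y dj[OF AB(2) CD(3)] unfolding AB(1) CD(1) by blast
      ultimately show ?thesis by blast
    qed
  qed
  moreover have "Y \<in> ?I" if XY: "X \<in> ?I" "Y \<subseteq> X" for X Y
  proof -
    obtain A B where AB: "X = A \<union> B" "A \<in> indeps M" "B \<in> indeps N"
      using XY(1) by auto
    have "Y \<inter> A \<in> indeps M" "Y \<inter> B \<in> indeps N"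
      using herM[OF AB(2)] herN[OF AB(3)] by blast+
    moreover have "Y = (Y \<inter> A) \<union> (Y \<inter> B)" using AB(1) XY(2) by blast
    ultimately show ?thesis by blast
  qed
  moreover have "{} \<in> ?I" using M N by (simp add: is_matroid_def)
  moreover have "?I \<subseteq> Pow (ground M \<union> ground N)" using sub sub' by blast
  moreover have "finite (ground M \<union> ground N)" using M N unfolding is_matroid_def by simp
  ultimately show ?thesis unfolding is_matroid_def direct_sum_def by simp
qed

lemma partition_matroid_is_matroid: "partition_matroid M \<Longrightarrow> is_matroid M"
  by (induction rule: partition_matroid.induct)
     (simp_all add: is_matroid_uniform is_matroid_direct_sum)


section \<open>Decision diagrams\<close>

datatype 'v vertex = Bot | Top | Inner 'v

text \<open>
  The values of the last three fields matter only on \<open>dd_nodes\<close>, the set of non-terminal nodes.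
\<close>

record ('v, 'a) diagram =
  dd_root :: "'v vertex"
  dd_nodes :: "'v set"
  dd_label :: "'v \<Rightarrow> 'a"
  dd_zero :: "'v \<Rightarrow> 'v vertex"
  dd_one :: "'v \<Rightarrow> 'v vertex"

text \<open>
  The non-terminal nodes of the complete binary decision tree are the 0-1 paths from the root of
  length less than \<open>n\<close>; a path of length \<open>n\<close> leads to one of the two terminals.
\<close>

definition path_set :: "'a list \<Rightarrow> bool list \<Rightarrow> 'a set" where
  "path_set es p = {es ! i | i. i < length p \<and> p ! i}"

definition tree_vertex :: "'a list \<Rightarrow> 'a set set \<Rightarrow> bool list \<Rightarrow> bool list vertex" where
  "tree_vertex es S p =
     (if length p < length es then Inner p else if path_set es p \<in> S then Top else Bot)"

definition decision_tree :: "'a list \<Rightarrow> 'a set set \<Rightarrow> (bool list, 'a) diagram" where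
  "decision_tree es S =
     \<lparr>dd_root = tree_vertex es S [],
      dd_nodes = {p. length p < length es},
      dd_label = (\<lambda>p. es ! length p),
      dd_zero = (\<lambda>p. tree_vertex es S (p @ [False])),
      dd_one = (\<lambda>p. tree_vertex es S (p @ [True]))\<rparr>"

definition eliminate :: "'v \<Rightarrow> 'v vertex \<Rightarrow> ('v, 'a) diagram \<Rightarrow> ('v, 'a) diagram" where
  "eliminate v t D =
     (let redirect = (\<lambda>w. if w = Inner v then t else w) in
      \<lparr>dd_root = redirect (dd_root D),
       dd_nodes = dd_nodes D - {v},
       dd_label = dd_label D,
       dd_zero = redirect \<circ> dd_zero D,
       dd_one = redirect \<circ> dd_one D\<rparr>)"

inductive bdd_step :: "('v, 'a) diagram \<Rightarrow> ('v, 'a) diagram \<Rightarrow> bool" where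
  merge: "\<lbrakk>u \<in> dd_nodes D; v \<in> dd_nodes D; u \<noteq> v; dd_label D u = dd_label D v;
           dd_zero D u = dd_zero D v; dd_one D u = dd_one D v\<rbrakk>
    \<Longrightarrow> bdd_step D (eliminate v (Inner u) D)"
| remove: "\<lbrakk>v \<in> dd_nodes D; dd_zero D v = dd_one D v\<rbrakk>
    \<Longrightarrow> bdd_step D (eliminate v (dd_zero D v) D)"

inductive zdd_step :: "('v, 'a) diagram \<Rightarrow> ('v, 'a) diagram \<Rightarrow> bool" where
  merge: "\<lbrakk>u \<in> dd_nodes D; v \<in> dd_nodes D; u \<noteq> v; dd_label D u = dd_label D v;
           dd_zero D u = dd_zero D v; dd_one D u = dd_one D v\<rbrakk>
    \<Longrightarrow> zdd_step D (eliminate v (Inner u) D)"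
| remove: "\<lbrakk>v \<in> dd_nodes D; dd_one D v = Bot\<rbrakk>
    \<Longrightarrow> zdd_step D (eliminate v (dd_zero D v) D)"

text \<open>
  The two predicates below hold for every result of an exhaustive application of the rules, in
  whatever order they are applied.
\<close>

definition is_BDD :: "'a list \<Rightarrow> 'a set set \<Rightarrow> (bool list, 'a) diagram \<Rightarrow> bool" where
  "is_BDD es S D \<longleftrightarrow> bdd_step\<^sup>*\<^sup>* (decision_tree es S) D \<and> \<not> (\<exists>D'. bdd_step D D')"

definition is_ZDD :: "'a list \<Rightarrow> 'a set set \<Rightarrow> (bool list, 'a) diagram \<Rightarrow> bool" where
  "is_ZDD es S D \<longleftrightarrow> zdd_step\<^sup>*\<^sup>* (decision_tree es S) D \<and> \<not> (\<exists>D'. zdd_step D D')"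

definition width_at :: "'a list \<Rightarrow> ('v, 'a) diagram \<Rightarrow> nat \<Rightarrow> nat" where
  "width_at es D i = card {v \<in> dd_nodes D. dd_label D v = es ! i}"

text \<open>As for the pathwidth, inserting \<open>0\<close> matters only for the empty ground set.\<close>

definition width :: "'a list \<Rightarrow> ('v, 'a) diagram \<Rightarrow> nat" where
  "width es D = Max (insert 0 (width_at es D ` {..<length es}))"

lemma normal_form_exists:
  assumes dec: "\<And>D D'. step D D' \<Longrightarrow> finite (dd_nodes D) \<Longrightarrow> dd_nodes D' \<subset> dd_nodes D"
  shows "finite (dd_nodes D) \<Longrightarrow> \<exists>D'. step\<^sup>*\<^sup>* D D' \<and> \<not> (\<exists>D''. step D' D'')"
proof (induction "card (dd_nodes D)" arbitrary: D rule: less_induct)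
  case less
  show ?case
  proof (cases "\<exists>D1. step D D1")
    case True
    then obtain D1 where D1: "step D D1" by blast
    then have "dd_nodes D1 \<subset> dd_nodes D" using dec less.prems by blast
    then have "card (dd_nodes D1) < card (dd_nodes D)" "finite (dd_nodes D1)"
      using less.prems by (auto intro: psubset_card_mono finite_subset)
    then obtain D2 where "step\<^sup>*\<^sup>* D1 D2" "\<not> (\<exists>D''. step D2 D'')"
      using less.hyps by blast
    then show ?thesis using D1 by (meson converse_rtranclp_into_rtranclp)
  qed blast
qed

lemma finite_decision_tree: "finite (dd_nodes (decision_tree es S))"
proof -
  have "{p :: bool list. length p < length es} \<subseteq> {p. set p \<subseteq> UNIV \<and> length p \<le> length es}" by auto
  moreover have "finite {p :: bool list. set p \<subseteq> UNIV \<and> length p \<le> length es}"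
    by (rule finite_lists_length_le) simp
  ultimately show ?thesis unfolding decision_tree_def by (auto intro: finite_subset)
qed

lemma BDD_exists: "\<exists>D. is_BDD es S D"
  unfolding is_BDD_def
  by (rule normal_form_exists[OF _ finite_decision_tree])
     (auto elim!: bdd_step.cases simp: eliminate_def Let_def)

lemma ZDD_exists: "\<exists>D. is_ZDD es S D"
  unfolding is_ZDD_def
  by (rule normal_form_exists[OF _ finite_decision_tree])
     (auto elim!: zdd_step.cases simp: eliminate_def Let_def)

end

theory Submission
  imports Defs "HOL-Library.Disjoint_Sets"
begin

text \<open>
  Order the ground set so that every block of the partition is contiguous. In a reduced diagram the
  nodes on a level represent pairwise distinct, nonempty families of completions. When the level
  lies inside a block \<open>B\<close> of rank \<open>r\<close> and a completion exists, the family of completions depends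
  only on the number \<open>c\<close> of elements of \<open>B\<close> chosen so far, and for \<open>m\<close> elements of \<open>B\<close> still to
  come all values \<open>c \<le> r - m\<close> may be identified. This leaves at most \<open>min r (card B - r) + 1\<close>
  families. Conversely, in every order some prefix contains exactly \<open>r\<close> elements of \<open>B\<close>, and its
  connectivity is at least \<open>min r (card B - r)\<close>.
\<close>

section \<open>Reduced decision diagrams\<close>

text \<open>
  \<open>accepts z n f w q\<close> evaluates the vertex \<open>w\<close> on the last \<open>length q\<close> of \<open>n\<close> decisions, where
  levels skipped by an arc are read as in a ZDD if \<open>z\<close> holds and as in a BDD otherwise. A node \<open>p\<close>
  is evaluated by its meaning \<open>f\<close> in the decision tree, not by following its arcs.
\<close>

fun accepts :: "bool \<Rightarrow> nat \<Rightarrow> (bool list \<Rightarrow> bool) \<Rightarrow> bool list vertex \<Rightarrow> bool list \<Rightarrow> bool" where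
  "accepts z n f w [] = (w = Top)"
| "accepts z n f w (b # q) =
    (if \<exists>p. w = Inner p \<and> length p + Suc (length q) = n then f ((case w of Inner p \<Rightarrow> p) @ b # q)
     else accepts z n f (if b \<and> z then Bot else w) q)"

lemma accepts_Bot [simp]: "\<not> accepts z n f Bot q"
  by (induction q) auto

lemma accepts_Inner:
  "length p + length q = n \<Longrightarrow> length p < n \<Longrightarrow> accepts z n f (Inner p) q = f (p @ q)"
  by (cases q) auto

lemma accepts_skip:
  "(\<And>p. w = Inner p \<Longrightarrow> length p + Suc (length q) \<noteq> n) \<Longrightarrow>
    accepts z n f w (b # q) = accepts z n f (if b \<and> z then Bot else w) q"
  by auto

text \<open>Both vertices lie on level \<open>k\<close> or later, so every decision before level
  \<open>k\<close> is a skipped one and acts on both alike: either both become \<open>Bot\<close> or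
  both stay. Agreement from level \<open>k\<close> on thus propagates to longer inputs.\<close>

lemma accepts_eq_longer:
  assumes "\<And>p. w = Inner p \<Longrightarrow> k \<le> length p" "\<And>p. w' = Inner p \<Longrightarrow> k \<le> length p"
    and "k \<le> n"
    and eq: "\<And>q. length q + k = n \<Longrightarrow> accepts z n f w q = accepts z n f w' q"
  shows "n \<le> length q + k \<Longrightarrow> accepts z n f w q = accepts z n f w' q"
proof (induction q)
  case Nil
  then show ?case using eq[of "[]"] \<open>k \<le> n\<close> by simp
next
  case (Cons b q)
  show ?case
  proof (cases "length (b # q) + k = n")
    case True
    then show ?thesis by (rule eq)
  next
    case False
    then have n: "n \<le> length q + k" using Cons.prems by simp
    have "accepts z n f w (b # q) = accepts z n f (if b \<and> z then Bot else w) q"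
      using n by (intro accepts_skip) (auto dest: assms(1))
    moreover have "accepts z n f w' (b # q) = accepts z n f (if b \<and> z then Bot else w') q"
      using n by (intro accepts_skip) (auto dest: assms(2))
    ultimately show ?thesis using Cons.IH[OF n] by auto
  qed
qed

section \<open>The invariant of the reduction rules\<close>

definition below :: "(bool list, 'a) diagram \<Rightarrow> nat \<Rightarrow> bool list vertex \<Rightarrow> bool" where
  "below D k w \<longleftrightarrow> (\<forall>p. w = Inner p \<longrightarrow> p \<in> dd_nodes D \<and> k \<le> length p)"

definition child :: "(bool list, 'a) diagram \<Rightarrow> bool \<Rightarrow> bool list \<Rightarrow> bool list vertex" where
  "child D b p = (if b then dd_one D p else dd_zero D p)"

text \<open>Nodes keep the tree path that names them, so \<open>length p\<close> remains the level
  of \<open>p\<close> throughout the reduction. The condition is local to each arc, because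
  \<open>accepts\<close> evaluates the target of an arc through \<open>f\<close>.\<close>

definition sound ::
  "bool \<Rightarrow> 'a list \<Rightarrow> (bool list \<Rightarrow> bool) \<Rightarrow> (bool list, 'a) diagram \<Rightarrow> bool" where
  "sound z es f D \<longleftrightarrow>
     (\<forall>p \<in> dd_nodes D. length p < length es \<and> dd_label D p = es ! length p \<and>
       (\<forall>b. below D (Suc (length p)) (child D b p) \<and>
         (\<forall>q. length q + Suc (length p) = length es \<longrightarrow>
           accepts z (length es) f (child D b p) q = f (p @ b # q))))"

lemma soundD:
  assumes "sound z es f D" "p \<in> dd_nodes D"
  shows "length p < length es" "dd_label D p = es ! length p"
    "below D (Suc (length p)) (child D b p)"
    "length q + Suc (length p) = length es \<Longrightarrow>
      accepts z (length es) f (child D b p) q = f (p @ b # q)"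
  using assms by (auto simp: sound_def)

lemma sound_decision_tree:
  "sound z es (\<lambda>p. path_set es p \<in> S) (decision_tree es S)"
proof -
  have "accepts z (length es) (\<lambda>p. path_set es p \<in> S) (tree_vertex es S p) q
      = (path_set es (p @ q) \<in> S)" if "length q + length p = length es" for p q
    using that by (cases q) (auto simp: tree_vertex_def)
  from this[of q "p @ [b]" for p q b] show ?thesis
    by (auto simp: sound_def decision_tree_def child_def below_def tree_vertex_def)
qed

text \<open>Common core of merging and removing: arcs into \<open>v\<close> may be redirected to any
  vertex that represents the same function and does not lie above \<open>v\<close>.\<close>

lemma sound_eliminate:
  assumes D: "sound z es f D" and v: "v \<in> dd_nodes D"
    and t: "below D (length v) t" "t \<noteq> Inner v"
    and eq: "\<And>q. length q + length v = length es \<Longrightarrow> accepts z (length es) f t q = f (v @ q)"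
  shows "sound z es f (eliminate v t D)"
proof -
  let ?n = "length es" and ?D = "eliminate v t D"
  have child: "child ?D b p = (if child D b p = Inner v then t else child D b p)" for b p
    by (simp add: child_def eliminate_def Let_def)
  have nodes: "dd_nodes ?D = dd_nodes D - {v}" "dd_label ?D = dd_label D"
    by (simp_all add: eliminate_def Let_def)
  \<comment> \<open>Arcs into \<open>v\<close> start on higher levels and may skip some, so the
    agreement of \<open>t\<close> with \<open>v\<close> is needed for longer inputs as well.\<close>
  have long: "accepts z ?n f t q = accepts z ?n f (Inner v) q" if "?n \<le> length q + length v" for q
  proof (rule accepts_eq_longer[OF _ _ _ _ that])
    show "length v \<le> length p" if "t = Inner p" for p using t that by (simp add: below_def)
    show "accepts z ?n f t q = accepts z ?n f (Inner v) q" if "length q + length v = ?n" for q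
      using eq[OF that] that soundD(1)[OF D v] by (subst accepts_Inner) auto
    show "length v \<le> ?n" using soundD(1)[OF D v] by simp
  qed simp
  have keep: "below ?D k w" if "below D k w" "w \<noteq> Inner v" for k w
    using that by (auto simp: below_def nodes)
  have "below ?D (Suc (length p)) (child ?D b p) \<and>
     (\<forall>q. length q + Suc (length p) = ?n \<longrightarrow> accepts z ?n f (child ?D b p) q = f (p @ b # q))"
    if p: "p \<in> dd_nodes D" for p b
  proof (cases "child D b p = Inner v")
    case True
    then have "Suc (length p) \<le> length v" using soundD(3)[OF D p, of b] by (simp add: below_def)
    then have "below D (Suc (length p)) t" using t(1) by (auto simp: below_def)
    moreover have "accepts z ?n f t q = f (p @ b # q)" if "length q + Suc (length p) = ?n" for q
      using long[of q] soundD(4)[OF D p that, of b] True that \<open>Suc (length p) \<le> length v\<close> by simp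
    ultimately show ?thesis using True keep t(2) by (simp add: child)
  next
    case False
    then show ?thesis
      using soundD(3,4)[OF D p, where b = b] keep by (simp add: child)
  qed
  then show ?thesis using D by (auto simp: sound_def nodes)
qed

lemma sound_merge:
  assumes D: "sound z es f D" and es: "distinct es"
    and uv: "u \<in> dd_nodes D" "v \<in> dd_nodes D" "u \<noteq> v" "dd_label D u = dd_label D v"
      "dd_zero D u = dd_zero D v" "dd_one D u = dd_one D v"
  shows "sound z es f (eliminate v (Inner u) D)"
proof (rule sound_eliminate[OF D uv(2)])
  \<comment> \<open>Since \<open>es\<close> has no repetitions, a label determines its
    level.\<close>
  have len: "length u = length v"
    using soundD(1,2)[OF D uv(1)] soundD(1,2)[OF D uv(2)] uv(4) es nth_eq_iff_index_eq by metis
  then show "below D (length v) (Inner u)" using uv by (simp add: below_def)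
  show "Inner u \<noteq> Inner v" using uv by simp
  fix q :: "bool list" assume q: "length q + length v = length es"
  then obtain b q' where bq: "q = b # q'" using soundD(1)[OF D uv(2)] by (cases q) auto
  have "f (u @ q) = accepts z (length es) f (child D b u) q'"
    using soundD(4)[OF D uv(1), of q' b] q len bq by simp
  also have "child D b u = child D b v" using uv by (simp add: child_def)
  also have "accepts z (length es) f (child D b v) q' = f (v @ q)"
    using soundD(4)[OF D uv(2), of q' b] q bq by simp
  finally show "accepts z (length es) f (Inner u) q = f (v @ q)"
    using q len soundD(1)[OF D uv(1)] by (subst accepts_Inner) auto
qed

text \<open>The hypothesis \<open>one\<close> covers both removal rules. It says that the children
  of \<open>v\<close> are exactly what the convention for a skipped level makes of its 0-successor,
  so skipping \<open>v\<close> does not change the function.\<close>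

lemma sound_remove:
  assumes D: "sound z es f D" and v: "v \<in> dd_nodes D"
    and one: "dd_one D v = (if z then Bot else dd_zero D v)"
  shows "sound z es f (eliminate v (dd_zero D v) D)"
proof (rule sound_eliminate[OF D v])
  have lev: "Suc (length v) \<le> length p" if "dd_zero D v = Inner p" for p
    using soundD(3)[OF D v, of False] that by (simp add: below_def child_def)
  show "below D (length v) (dd_zero D v)"
    using soundD(3)[OF D v, of False] by (auto simp: below_def child_def)
  show "dd_zero D v \<noteq> Inner v" using lev by force
  fix q :: "bool list" assume q: "length q + length v = length es"
  then obtain b q' where bq: "q = b # q'" using soundD(1)[OF D v] by (cases q) auto
  have "accepts z (length es) f (dd_zero D v) q
      = accepts z (length es) f (if b \<and> z then Bot else dd_zero D v) q'"
    unfolding bq using lev q bq by (intro accepts_skip) force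
  also have "(if b \<and> z then Bot else dd_zero D v) = child D b v"
    using one by (simp add: child_def)
  also have "accepts z (length es) f (child D b v) q' = f (v @ q)"
    using soundD(4)[OF D v, of q' b] q bq by simp
  finally show "accepts z (length es) f (dd_zero D v) q = f (v @ q)" .
qed

section \<open>Canonicity of reduced diagrams\<close>

definition reduced :: "bool \<Rightarrow> (bool list, 'a) diagram \<Rightarrow> bool" where
  "reduced z D \<longleftrightarrow>
     (\<forall>u \<in> dd_nodes D. \<forall>v \<in> dd_nodes D. dd_label D u = dd_label D v \<longrightarrow>
       dd_zero D u = dd_zero D v \<longrightarrow> dd_one D u = dd_one D v \<longrightarrow> u = v) \<and>
     (\<forall>v \<in> dd_nodes D. dd_one D v \<noteq> (if z then Bot else dd_zero D v))"

lemma is_BDD_sound_reduced: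
  assumes "is_BDD es S D" "distinct es"
  shows "sound False es (\<lambda>p. path_set es p \<in> S) D \<and> reduced False D"
proof -
  have "bdd_step\<^sup>*\<^sup>* (decision_tree es S) D" and nf: "\<nexists>D'. bdd_step D D'"
    using assms by (auto simp: is_BDD_def)
  from this(1) have "sound False es (\<lambda>p. path_set es p \<in> S) D"
  proof (induction rule: rtranclp_induct)
    case base
    show ?case by (rule sound_decision_tree)
  next
    case (step D1 D2)
    from step.hyps(2) show ?case
    proof cases
      case (merge u v)
      then show ?thesis using sound_merge[OF step.IH assms(2)] by blast
    next
      case (remove v)
      then show ?thesis using sound_remove[OF step.IH, of v] by simp
    qed
  qed
  moreover have "reduced False D"
    using nf unfolding reduced_def by (auto intro: bdd_step.intros) (metis bdd_step.remove)
  ultimately show ?thesis ..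
qed

lemma is_ZDD_sound_reduced:
  assumes "is_ZDD es S D" "distinct es"
  shows "sound True es (\<lambda>p. path_set es p \<in> S) D \<and> reduced True D"
proof -
  have "zdd_step\<^sup>*\<^sup>* (decision_tree es S) D" and nf: "\<nexists>D'. zdd_step D D'"
    using assms by (auto simp: is_ZDD_def)
  from this(1) have "sound True es (\<lambda>p. path_set es p \<in> S) D"
  proof (induction rule: rtranclp_induct)
    case base
    show ?case by (rule sound_decision_tree)
  next
    case (step D1 D2)
    from step.hyps(2) step.IH assms(2) show ?case
      by cases (auto intro: sound_merge sound_remove)
  qed
  moreover have "reduced True D"
    using nf unfolding reduced_def by (auto intro: zdd_step.intros)
  ultimately show ?thesis ..
qed

text \<open>The classical canonicity argument, by induction from the last level upwards: vertices
  with the same function have the same cofactors, which coincide by induction, and reducedness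
  leaves only one vertex with given cofactors.\<close>

lemma reduced_canonical:
  assumes D: "sound z es f D" and red: "reduced z D"
  shows "k \<le> length es \<Longrightarrow> below D k w \<Longrightarrow> below D k w' \<Longrightarrow>
    (\<And>q. length q + k = length es \<Longrightarrow> accepts z (length es) f w q = accepts z (length es) f w' q) \<Longrightarrow>
    w = w'"
proof (induction k arbitrary: w w' rule: inc_induct)
  case base
  \<comment> \<open>After the last decision only terminals remain, and the empty input separates
    them.\<close>
  have "\<not> below D (length es) (Inner p)" for p
    using soundD(1)[OF D, of p] by (auto simp: below_def)
  then show ?case using base(1,2) base(3)[of "[]"] by (cases w; cases w') auto
next
  case (step k)
  let ?n = "length es"
  \<comment> \<open>The cofactor of \<open>w\<close> for decision \<open>b\<close> on level
    \<open>k\<close>; if \<open>w\<close> is not a node of that level, the convention for skipped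
    levels applies.\<close>
  define down where "down b w = (if \<exists>p. w = Inner p \<and> length p = k
      then child D b (case w of Inner p \<Rightarrow> p) else if b \<and> z then Bot else w)" for b w
  have down: "below D (Suc k) (down b w) \<and>
      (\<forall>q. length q + Suc k = ?n \<longrightarrow> accepts z ?n f (down b w) q = accepts z ?n f w (b # q))"
    if w: "below D k w" for b w
  proof (cases "\<exists>p. w = Inner p \<and> length p = k")
    case True
    then obtain p where p: "w = Inner p" "length p = k" "p \<in> dd_nodes D"
      using w by (auto simp: below_def)
    then have "down b w = child D b p" by (simp add: down_def)
    then show ?thesis using soundD(3,4)[OF D p(3), where b = b] p by simp
  next
    case False
    then have "down b w = (if b \<and> z then Bot else w)" unfolding down_def by (rule if_not_P)
    moreover have "accepts z ?n f w (b # q) = accepts z ?n f (if b \<and> z then Bot else w) q"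
      if "length q + Suc k = ?n" for q
      using False that by (intro accepts_skip) auto
    moreover have "below D (Suc k) (if b \<and> z then Bot else w)"
      using w False by (auto simp: below_def le_less Suc_le_eq)
    ultimately show ?thesis by simp
  qed
  have eq: "down b w = down b w'" for b
  proof (rule step.IH)
    show "below D (Suc k) (down b w)" "below D (Suc k) (down b w')"
      using down step.prems(1,2) by blast+
    fix q :: "bool list" assume q: "length q + Suc k = ?n"
    then have "accepts z ?n f w (b # q) = accepts z ?n f w' (b # q)"
      by (intro step.prems(3)) simp
    then show "accepts z ?n f (down b w) q = accepts z ?n f (down b w') q"
      using down[OF step.prems(1), of b] down[OF step.prems(2), of b] q by blast
  qed
  \<comment> \<open>If just one of the two vertices is a node of level \<open>k\<close>, its
    cofactors are those of a skipped level, so it could have been removed.\<close>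
  have mixed: False
    if "down False x = down False y" "down True x = down True y" "below D k x"
      "x = Inner p" "length p = k" "\<nexists>p. y = Inner p \<and> length p = k" for x y p
  proof -
    have "dd_zero D p = y" "dd_one D p = (if z then Bot else y)"
      using that by (auto simp: down_def child_def)
    moreover have "p \<in> dd_nodes D" using that by (simp add: below_def)
    ultimately show False using red by (auto simp: reduced_def)
  qed
  consider p p' where "w = Inner p" "length p = k" "w' = Inner p'" "length p' = k"
    | "\<nexists>p. w = Inner p \<and> length p = k" "\<nexists>p. w' = Inner p \<and> length p = k"
    using mixed[OF eq eq step.prems(1)] mixed[OF eq[symmetric] eq[symmetric] step.prems(2)] by blast
  then show ?case
  proof cases
    case 1
    then have "dd_zero D p = dd_zero D p'" "dd_one D p = dd_one D p'"
      using eq[of False] eq[of True] by (auto simp: down_def child_def)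
    moreover have "p \<in> dd_nodes D" "p' \<in> dd_nodes D"
      using 1 step.prems(1,2) by (auto simp: below_def)
    moreover from this have "dd_label D p = dd_label D p'"
      using soundD(2)[OF D] 1 by simp
    ultimately show ?thesis using red 1 by (simp add: reduced_def)
  next
    case 2
    \<comment> \<open>Skipping a level with decision \<open>False\<close> changes nothing in either
      convention.\<close>
    then have "down False w = w" "down False w' = w'"
      unfolding down_def by (simp_all only: if_False simp_thms)
    then show ?thesis using eq[of False] by metis
  qed
qed

section \<open>Counting the nodes of a level\<close>

definition completions :: "'a list \<Rightarrow> 'a set set \<Rightarrow> bool list \<Rightarrow> bool list set" where
  "completions es S p = {q. length p + length q = length es \<and> path_set es (p @ q) \<in> S}"

text \<open>By canonicity, nodes of one level with equal completions coincide, so \<open>key\<close>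
  is injective on the level. Paths without completions may be ignored, because a node with none
  would coincide with \<open>Bot\<close>.\<close>

lemma width_at_le_card:
  fixes key :: "bool list \<Rightarrow> 'b"
  assumes D: "sound z es (\<lambda>p. path_set es p \<in> S) D" and red: "reduced z D"
    and es: "distinct es" "i < length es" and fin: "finite A"
    and key: "\<And>p. length p = i \<Longrightarrow> completions es S p \<noteq> {} \<Longrightarrow> key p \<in> A"
    and det: "\<And>p p'. length p = i \<Longrightarrow> length p' = i \<Longrightarrow> completions es S p \<noteq> {} \<Longrightarrow>
      completions es S p' \<noteq> {} \<Longrightarrow> key p = key p' \<Longrightarrow> completions es S p = completions es S p'"
  shows "width_at es D i \<le> card A"
proof -
  let ?N = "{v \<in> dd_nodes D. dd_label D v = es ! i}" and ?f = "\<lambda>p. path_set es p \<in> S"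
  have len: "length p = i" if "p \<in> ?N" for p
    using that soundD(1,2)[OF D, of p] es by (auto simp: nth_eq_iff_index_eq)
  have acc: "accepts z (length es) ?f (Inner p) q \<longleftrightarrow> q \<in> completions es S p"
    if "p \<in> ?N" "length q + i = length es" for p q
    using that len[OF that(1)] es by (subst accepts_Inner) (auto simp: completions_def)
  have bel: "below D i (Inner p)" if "p \<in> ?N" for p
    using that len[OF that] by (simp add: below_def)
  have ne: "completions es S p \<noteq> {}" if p: "p \<in> ?N" for p
  proof
    assume "completions es S p = {}"
    then have "Inner p = Bot"
      using es acc[OF p] by (intro reduced_canonical[OF D red _ bel[OF p]]) (auto simp: below_def)
    then show False by simp
  qed
  have "inj_on key ?N"
  proof (rule inj_onI)
    fix p p' assume p: "p \<in> ?N" and p': "p' \<in> ?N" and "key p = key p'"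
    then have "completions es S p = completions es S p'"
      using det[OF len len ne ne] by blast
    then have "Inner p = Inner p'"
      using es acc[OF p] acc[OF p']
      by (intro reduced_canonical[OF D red _ bel[OF p] bel[OF p']]) auto
    then show "p = p'" by simp
  qed
  moreover have "key ` ?N \<subseteq> A" using key len ne by blast
  ultimately show ?thesis unfolding width_at_def using fin card_inj_on_le by blast
qed

section \<open>Partition matroids\<close>

text \<open>One form for both families: \<open>R B = {..r B}\<close> yields the independent sets and
  \<open>R B = {r B}\<close> the bases.\<close>

definition block_sets :: "'a set set \<Rightarrow> ('a set \<Rightarrow> nat set) \<Rightarrow> 'a set set" where
  "block_sets P R = {X. X \<subseteq> \<Union>P \<and> (\<forall>B\<in>P. card (X \<inter> B) \<in> R B)}"

text \<open>Nested direct sums flatten: the partition of a sum is the union of the partitions of its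
  summands.\<close>

lemma partition_matroid_blocks:
  assumes "partition_matroid M"
  shows "\<exists>P r. finite P \<and> partition_on (ground M) P \<and> finite (ground M) \<and>
    (\<forall>B\<in>P. r B \<le> card B) \<and> indeps M = block_sets P (\<lambda>B. {..r B})"
  using assms
proof (induction rule: partition_matroid.induct)
  case (uniform E r)
  \<comment> \<open>A partition has no empty part, hence the case distinction.\<close>
  let ?P = "if E = {} then {} else {E}"
  have "indeps (uniform_matroid E r) = block_sets ?P (\<lambda>B. {..r})"
    by (auto simp: uniform_matroid_def block_sets_def Int_absorb2)
  moreover have "finite ?P" "partition_on (ground (uniform_matroid E r)) ?P"
    "finite (ground (uniform_matroid E r))" "\<forall>B\<in>?P. r \<le> card B"
    using uniform by (auto simp: uniform_matroid_def partition_on_def disjoint_def)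
  ultimately show ?case by (intro exI[of _ ?P] exI[of _ "\<lambda>_. r"] conjI)
next
  case (sum M N)
  from sum.IH(1) obtain P r where P: "finite P" "partition_on (ground M) P" "finite (ground M)"
      "\<forall>B\<in>P. r B \<le> card B" "indeps M = block_sets P (\<lambda>B. {..r B})" by blast
  from sum.IH(2) obtain Q s where Q: "finite Q" "partition_on (ground N) Q" "finite (ground N)"
      "\<forall>B\<in>Q. s B \<le> card B" "indeps N = block_sets Q (\<lambda>B. {..s B})" by blast
  have U: "\<Union>P = ground M" "\<Union>Q = ground N" using P(2) Q(2) by (auto simp: partition_on_def)
  have part: "partition_on (ground M \<union> ground N) (P \<union> Q)"
    using P(2) Q(2) sum.hyps(3)
    by (auto simp: partition_on_def intro!: disjoint_union)
  \<comment> \<open>Parts are nonempty and the ground sets are disjoint, so no part is shared and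
    the rank functions can be glued.\<close>
  have PQ: "B \<notin> P" if "B \<in> Q" for B
  proof
    assume "B \<in> P"
    then have "B \<subseteq> ground M \<inter> ground N" using that U by blast
    then show False using that sum.hyps(3) Q(2) by (simp add: partition_on_def)
  qed
  define t where "t B = (if B \<in> P then r B else s B)" for B
  have "indeps (direct_sum M N) = block_sets (P \<union> Q) (\<lambda>B. {..t B})"
  proof (intro equalityI subsetI)
    fix Z assume "Z \<in> indeps (direct_sum M N)"
    then obtain X Y where XY: "Z = X \<union> Y" "X \<in> block_sets P (\<lambda>B. {..r B})"
        "Y \<in> block_sets Q (\<lambda>B. {..s B})"
      by (auto simp: direct_sum_def P(5) Q(5))
    have sub: "X \<subseteq> ground M" "Y \<subseteq> ground N" using XY U by (auto simp: block_sets_def)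
    have "Z \<inter> B = X \<inter> B" if "B \<in> P" for B
    proof -
      have "B \<subseteq> ground M" using that U by blast
      then show ?thesis using XY(1) sub sum.hyps(3) by blast
    qed
    moreover have "Z \<inter> B = Y \<inter> B" if "B \<in> Q" for B
    proof -
      have "B \<subseteq> ground N" using that U by blast
      then show ?thesis using XY(1) sub sum.hyps(3) by blast
    qed
    ultimately show "Z \<in> block_sets (P \<union> Q) (\<lambda>B. {..t B})"
      using XY PQ by (auto simp: block_sets_def t_def)
  next
    fix Z assume Z: "Z \<in> block_sets (P \<union> Q) (\<lambda>B. {..t B})"
    have "(Z \<inter> ground M) \<inter> B = Z \<inter> B" if "B \<in> P" for B using that U by auto
    then have "Z \<inter> ground M \<in> indeps M"
      using Z U(1) by (simp add: block_sets_def t_def P(5) ball_Un)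
    moreover have "(Z \<inter> ground N) \<inter> B = Z \<inter> B" if "B \<in> Q" for B using that U by auto
    then have "Z \<inter> ground N \<in> indeps N"
      using Z PQ U(2) by (simp add: block_sets_def t_def Q(5) ball_Un)
    moreover have "Z = (Z \<inter> ground M) \<union> (Z \<inter> ground N)"
      using Z U by (auto simp: block_sets_def)
    ultimately show "Z \<in> indeps (direct_sum M N)" by (auto simp: direct_sum_def)
  qed
  moreover have "\<forall>B\<in>P \<union> Q. t B \<le> card B" using P(4) Q(4) by (auto simp: t_def)
  moreover have "ground (direct_sum M N) = ground M \<union> ground N" by (simp add: direct_sum_def)
  ultimately show ?case using part P(1,3) Q(1,3)
    by (intro exI[of _ "P \<union> Q"] exI[of _ t] conjI) simp_all
qed

lemma card_eq_sum_blocks: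
  assumes "finite P" "disjoint P" "finite X" "X \<subseteq> \<Union>P"
  shows "card X = (\<Sum>B\<in>P. card (X \<inter> B))"
proof -
  have "X = (\<Union>B\<in>P. X \<inter> B)" using assms by auto
  then have "card X = card (\<Union>B\<in>P. X \<inter> B)" by simp
  also have "\<dots> = (\<Sum>B\<in>P. card (X \<inter> B))"
    using assms by (intro card_UN_disjoint) (auto simp: disjoint_def)
  finally show ?thesis .
qed

text \<open>The blocks are listed one after another, so at each position a block not containing the
  current element is either untouched or exhausted.\<close>

lemma ex_contiguous_order:
  assumes "finite P" "disjoint P" "finite (\<Union>P)"
  shows "\<exists>es \<in> permutations_of_set (\<Union>P). \<forall>i<length es. \<forall>C\<in>P. es ! i \<notin> C \<longrightarrow>
    C \<inter> set (take i es) = {} \<or> C \<inter> set (drop i es) = {}"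
  using assms
proof (induction rule: finite_induct)
  case empty
  show ?case by auto
next
  case (insert B P)
  have disj: "B \<inter> \<Union>P = {}" using insert.hyps(2) insert.prems(1) by (auto simp: disjoint_def)
  have "disjoint P" using insert.prems(1) by (auto simp: disjoint_def)
  then obtain es where es: "set es = \<Union>P" "distinct es"
    and IH: "\<And>i C. i < length es \<Longrightarrow> C \<in> P \<Longrightarrow> es ! i \<notin> C \<Longrightarrow>
      C \<inter> set (take i es) = {} \<or> C \<inter> set (drop i es) = {}"
    using insert.IH insert.prems(2) by (auto simp: permutations_of_set_def)
  obtain ys where ys: "set ys = B" "distinct ys"
    using insert.prems(2) finite_distinct_list[of B] by auto
  have "C \<inter> set (take i (ys @ es)) = {} \<or> C \<inter> set (drop i (ys @ es)) = {}"
    if i: "i < length (ys @ es)" and C: "C \<in> insert B P" "(ys @ es) ! i \<notin> C" for i C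
  proof (cases "i < length ys")
    case True
    then have "C \<noteq> B" using C ys by (auto simp: nth_append)
    then have "C \<inter> B = {}" using C disj by auto
    moreover have "set (take i (ys @ es)) \<subseteq> B"
      using True ys by (auto dest: in_set_takeD)
    ultimately show ?thesis by blast
  next
    case False
    show ?thesis
    proof (cases "C = B")
      case True
      have "set (drop i (ys @ es)) \<subseteq> \<Union>P" using False es by (auto dest: in_set_dropD)
      then show ?thesis using True disj by blast
    next
      case CB: False
      then have CP: "C \<in> P" "C \<inter> B = {}" using C disj by auto
      have "i - length ys < length es" "es ! (i - length ys) \<notin> C"
        using False i C by (auto simp: nth_append)
      from IH[OF this(1) CP(1) this(2)] show ?thesis using False CP ys by auto
    qed
  qed
  moreover have "ys @ es \<in> permutations_of_set (\<Union>(insert B P))"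
    using ys es disj by (auto simp: permutations_of_set_def)
  ultimately show ?case by blast
qed

section \<open>Level widths for families given by block counts\<close>

lemma path_set_append:
  assumes "length p \<le> length es"
  shows "path_set es (p @ q) = path_set es p \<union> path_set (drop (length p) es) q"
proof (intro equalityI subsetI)
  fix x assume "x \<in> path_set es (p @ q)"
  then obtain i where i: "x = es ! i" "i < length p + length q" "(p @ q) ! i"
    by (auto simp: path_set_def)
  show "x \<in> path_set es p \<union> path_set (drop (length p) es) q"
  proof (cases "i < length p")
    case True
    then show ?thesis using i by (auto simp: path_set_def nth_append)
  next
    case False
    then have "x = drop (length p) es ! (i - length p)" "q ! (i - length p)"
      "i - length p < length q"
      using i assms by (auto simp: nth_append)
    then show ?thesis unfolding path_set_def by blast
  qed
next
  fix x assume "x \<in> path_set es p \<union> path_set (drop (length p) es) q"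
  then show "x \<in> path_set es (p @ q)"
  proof
    assume "x \<in> path_set es p"
    then show ?thesis by (force simp: path_set_def nth_append)
  next
    assume "x \<in> path_set (drop (length p) es) q"
    then obtain j where "x = es ! (length p + j)" "j < length q" "q ! j"
      using assms by (auto simp: path_set_def)
    then have "x = es ! (length p + j)" "length p + j < length (p @ q)" "(p @ q) ! (length p + j)"
      by auto
    then show ?thesis unfolding path_set_def by blast
  qed
qed

lemma path_set_subset_take: "length p \<le> length es \<Longrightarrow> path_set es p \<subseteq> set (take (length p) es)"
  by (force simp: path_set_def in_set_conv_nth)

lemma path_set_subset: "length p \<le> length es \<Longrightarrow> path_set es p \<subseteq> set es"
  by (auto simp: path_set_def)

text \<open>Only \<open>B\<close> may be cut by the split into \<open>T\<close> and
  \<open>F\<close>. Any other block meets at most one side, so its count in the new set is inherited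
  from \<open>X \<union> Y\<close> or from \<open>X' \<union> Y'\<close>; for \<open>B\<close> the
  hypothesis \<open>step\<close> transfers the count.\<close>

lemma block_sets_exchange:
  assumes disj: "T \<inter> F = {}" and fin: "finite B" and sub: "X \<subseteq> T" "X' \<subseteq> T" "Y \<subseteq> F" "Y' \<subseteq> F"
    and split: "\<And>C. C \<in> P \<Longrightarrow> C \<noteq> B \<Longrightarrow> C \<inter> T = {} \<or> C \<inter> F = {}"
    and mem: "X \<union> Y \<in> block_sets P R" "X' \<union> Y' \<in> block_sets P R"
    and step: "\<And>m. m \<le> card (B \<inter> F) \<Longrightarrow> card (X \<inter> B) + m \<in> R B \<Longrightarrow> card (X' \<inter> B) + m \<in> R B"
  shows "X' \<union> Y \<in> block_sets P R"
proof -
  have "card ((X' \<union> Y) \<inter> C) \<in> R C" if C: "C \<in> P" for C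
  proof (cases "C = B")
    case True
    have add: "card ((Z \<union> Y) \<inter> B) = card (Z \<inter> B) + card (Y \<inter> B)" if "Z \<subseteq> T" for Z
      unfolding Int_Un_distrib2 using that fin sub disj by (intro card_Un_disjoint) auto
    have "card (Y \<inter> B) \<le> card (B \<inter> F)" using sub fin by (intro card_mono) auto
    then show ?thesis
      using True C mem(1) step[of "card (Y \<inter> B)"] add[OF sub(1)] add[OF sub(2)]
      by (auto simp: block_sets_def)
  next
    case False
    then consider "C \<inter> T = {}" | "C \<inter> F = {}" using split C by blast
    then show ?thesis
    proof cases
      case 1
      then have "(X' \<union> Y) \<inter> C = (X \<union> Y) \<inter> C" using sub by blast
      then show ?thesis using mem(1) C by (simp add: block_sets_def)
    next
      case 2
      then have "(X' \<union> Y) \<inter> C = (X' \<union> Y') \<inter> C" using sub by blast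
      then show ?thesis using mem(2) C by (simp add: block_sets_def)
    qed
  qed
  then show ?thesis using mem by (simp add: block_sets_def)
qed

lemma width_at_block_sets:
  fixes r :: "'a set \<Rightarrow> nat"
  assumes D: "sound z es (\<lambda>p. path_set es p \<in> block_sets P R) D" and red: "reduced z D"
    and R: "R B = {..r B} \<or> R B = {r B}"
    and es: "distinct es" "i < length es" "B \<subseteq> set es"
    and B: "B \<in> P" "r B \<le> card B"
    and split: "\<And>C. C \<in> P \<Longrightarrow> C \<noteq> B \<Longrightarrow>
      C \<inter> set (take i es) = {} \<or> C \<inter> set (drop i es) = {}"
  shows "width_at es D i \<le> min (r B) (card B - r B) + 1"
proof -
  let ?T = "set (take i es)" and ?F = "set (drop i es)" and ?S = "block_sets P R"
  define a where "a = card (B \<inter> ?T)"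
  define m where "m = card (B \<inter> ?F)"
  have TF: "?T \<inter> ?F = {}" by (rule set_take_disj_set_drop_if_distinct[OF es(1)]) simp
  have fin: "finite B" using es(3) finite_subset by blast
  have "set es = ?T \<union> ?F" by (metis append_take_drop_id set_append)
  then have "B = (B \<inter> ?T) \<union> (B \<inter> ?F)" using es(3) by blast
  then have "card B = card ((B \<inter> ?T) \<union> (B \<inter> ?F))" by simp
  also have "\<dots> = a + m"
    unfolding a_def m_def using fin TF by (intro card_Un_disjoint) auto
  finally have am: "card B = a + m" .
  \<comment> \<open>With at most \<open>m\<close> elements of \<open>B\<close> to come, all counts
    up to \<open>r B - m\<close> are equally harmless for independence, so they are identified. If
    \<open>m\<close> exceeds \<open>r B\<close>, the truncated difference is 0 and
    \<open>key\<close> is the plain count.\<close>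
  define key where "key p = max (card (path_set es p \<inter> B)) (r B - m)" for p
  have sub: "path_set es p \<subseteq> ?T" if "length p = i" for p
    using path_set_subset_take[of p es] that es by simp
  have app: "path_set es (p @ q) = path_set es p \<union> path_set (drop i es) q"
    "path_set (drop i es) q \<subseteq> ?F" if "length p = i" "length p + length q = length es" for p q
    using path_set_append[of p es q] path_set_subset[of q "drop i es"] that es by auto
  \<comment> \<open>A completion keeps the count at most \<open>r B\<close>. For bases it also
    forces at least \<open>r B - m\<close>, so there \<open>key\<close> is the count itself.\<close>
  have bound: "card (path_set es p \<inter> B) \<le> min a (r B) \<and>
      (R B = {r B} \<longrightarrow> r B - m \<le> card (path_set es p \<inter> B))"
    if p: "length p = i" "completions es ?S p \<noteq> {}" for p
  proof -
    obtain q where q: "length p + length q = length es" "path_set es (p @ q) \<in> ?S"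
      using p(2) by (auto simp: completions_def)
    let ?X = "path_set es p" and ?Y = "path_set (drop i es) q"
    have "card ((?X \<union> ?Y) \<inter> B) = card (?X \<inter> B) + card (?Y \<inter> B)"
      unfolding Int_Un_distrib2 using fin sub[OF p(1)] app(2)[OF p(1) q(1)] TF
      by (intro card_Un_disjoint) auto
    moreover have "card ((?X \<union> ?Y) \<inter> B) \<in> R B"
      using q(2) B(1) app(1)[OF p(1) q(1)] by (simp add: block_sets_def)
    moreover have "card (?X \<inter> B) \<le> a" "card (?Y \<inter> B) \<le> m"
      unfolding a_def m_def using sub[OF p(1)] app(2)[OF p(1) q(1)] fin
      by (auto intro!: card_mono)
    moreover have "k \<le> r B \<and> (R B = {r B} \<longrightarrow> k = r B)" if "k \<in> R B" for k
      using R that by (metis atMost_iff order_refl singletonD)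
    ultimately show ?thesis by fastforce
  qed
  have incl: "completions es ?S p \<subseteq> completions es ?S p'"
    if p: "length p = i" "length p' = i" "completions es ?S p \<noteq> {}" "completions es ?S p' \<noteq> {}"
      "key p = key p'" for p p'
  proof
    fix q assume "q \<in> completions es ?S p"
    then have q: "length p + length q = length es" "path_set es (p @ q) \<in> ?S"
      by (auto simp: completions_def)
    obtain q' where q': "length p' + length q' = length es" "path_set es (p' @ q') \<in> ?S"
      using p(4) by (auto simp: completions_def)
    have "path_set es p' \<union> path_set (drop i es) q \<in> ?S"
    proof (rule block_sets_exchange[OF TF fin])
      show "path_set es p \<subseteq> ?T" "path_set es p' \<subseteq> ?T" using sub p by blast+
      show "path_set (drop i es) q \<subseteq> ?F" by (rule app(2)[OF p(1) q(1)])
      show "path_set (drop i es) q' \<subseteq> ?F" by (rule app(2)[OF p(2) q'(1)])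
      show "path_set es p \<union> path_set (drop i es) q \<in> ?S"
        using q(2) app(1)[OF p(1) q(1)] by simp
      show "path_set es p' \<union> path_set (drop i es) q' \<in> ?S"
        using q'(2) app(1)[OF p(2) q'(1)] by simp
      \<comment> \<open>Equal keys mean equal counts or two counts of at most
        \<open>r B - m\<close>.\<close>
      show "card (path_set es p' \<inter> B) + j \<in> R B"
        if "j \<le> card (B \<inter> ?F)" "card (path_set es p \<inter> B) + j \<in> R B" for j
        using R
      proof
        assume "R B = {..r B}"
        then show ?thesis
          using that p(5) unfolding key_def m_def[symmetric]
          by (auto simp: max_def split: if_splits)
      next
        assume "R B = {r B}"
        then show ?thesis
          using that p(5) bound[OF p(1,3)] bound[OF p(2,4)] by (simp add: key_def)
      qed
    qed (use split in blast)
    then show "q \<in> completions es ?S p'"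
      using q p app(1)[of p' q] by (simp add: completions_def)
  qed
  have "width_at es D i \<le> card {r B - m..min a (r B)}"
  proof (rule width_at_le_card[OF D red es(1,2), where key = key])
    show "key p \<in> {r B - m..min a (r B)}" if "length p = i" "completions es ?S p \<noteq> {}" for p
      using bound[OF that] B(2) am by (auto simp: key_def)
    show "completions es ?S p = completions es ?S p'"
      if "length p = i" "length p' = i" "completions es ?S p \<noteq> {}" "completions es ?S p' \<noteq> {}"
        "key p = key p'" for p p'
      using incl[OF that] incl[OF that(2,1,4,3) that(5)[symmetric]] by blast
  qed simp
  \<comment> \<open>The size of the interval follows from \<open>card B = a + m\<close> and
    \<open>r B \<le> card B\<close>.\<close>
  also have "\<dots> \<le> min (r B) (card B - r B) + 1" using am B(2) by auto
  finally show ?thesis .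
qed

section \<open>Bases, rank, connectivity and pathwidth in terms of blocks\<close>

locale block_matroid =
  fixes M :: "'a matroid" and P :: "'a set set" and r :: "'a set \<Rightarrow> nat"
  assumes finite_blocks: "finite P" and part: "partition_on (ground M) P"
    and finite_ground: "finite (ground M)"
    and rank_le_card: "B \<in> P \<Longrightarrow> r B \<le> card B"
    and indeps: "indeps M = block_sets P (\<lambda>B. {..r B})"
begin

lemma Union_blocks: "\<Union>P = ground M" and disjoint_blocks: "disjoint P"
  using part by (simp_all add: partition_on_def)

lemma finite_block: "B \<in> P \<Longrightarrow> finite B"
  by (metis Union_blocks Union_upper finite_ground finite_subset)

lemma bases_eq: "bases M = block_sets P (\<lambda>B. {r B})"
proof (intro equalityI subsetI)
  fix X assume "X \<in> bases M"
  then have X: "X \<subseteq> \<Union>P" "\<And>B. B \<in> P \<Longrightarrow> card (X \<inter> B) \<le> r B"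
    and max: "\<And>Y. Y \<in> block_sets P (\<lambda>B. {..r B}) \<Longrightarrow> X \<subseteq> Y \<Longrightarrow> Y = X"
    by (auto simp: bases_def indeps block_sets_def)
  have "card (X \<inter> B) = r B" if B: "B \<in> P" for B
  proof (rule ccontr)
    assume "card (X \<inter> B) \<noteq> r B"
    then have lt: "card (X \<inter> B) < r B" using X(2)[OF B] by simp
    then have "X \<inter> B \<noteq> B" using rank_le_card[OF B] by auto
    then obtain y where y: "y \<in> B" "y \<notin> X" by blast
    have "card (insert y X \<inter> C) \<le> r C" if C: "C \<in> P" for C
    proof (cases "C = B")
      case True
      have "card (insert y X \<inter> B) = Suc (card (X \<inter> B))"
        using y finite_block[OF B] by (simp add: Int_insert_left)
      then show ?thesis using True lt by simp
    next
      case False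
      then have "y \<notin> C" using y disjoint_blocks B C by (auto simp: disjoint_def)
      then show ?thesis using X(2)[OF C] by simp
    qed
    then have "insert y X \<in> block_sets P (\<lambda>B. {..r B})"
      using X(1) y B by (auto simp: block_sets_def)
    then show False using max y by blast
  qed
  then show "X \<in> block_sets P (\<lambda>B. {r B})" using X by (simp add: block_sets_def)
next
  fix X assume X: "X \<in> block_sets P (\<lambda>B. {r B})"
  have "Y = X" if Y: "Y \<in> block_sets P (\<lambda>B. {..r B})" "X \<subseteq> Y" for Y
  proof -
    have "Y \<inter> B = X \<inter> B" if B: "B \<in> P" for B
      using X Y B finite_block[OF B]
      by (intro card_seteq[symmetric]) (auto simp: block_sets_def)
    moreover have "Y = (\<Union>B\<in>P. Y \<inter> B)" "X = (\<Union>B\<in>P. X \<inter> B)"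
      using X Y by (auto simp: block_sets_def)
    ultimately show ?thesis by (metis (no_types, lifting) SUP_cong)
  qed
  then show "X \<in> bases M" using X by (auto simp: bases_def indeps block_sets_def)
qed

text \<open>The bound holds block by block, and independent choices of subsets \<open>J B\<close> of
  that size inside the blocks attain it.\<close>

lemma rank_eq:
  assumes X: "X \<subseteq> ground M"
  shows "matroid_rank M X = (\<Sum>B\<in>P. min (card (X \<inter> B)) (r B))"
  unfolding matroid_rank_def
proof (rule Max_eqI)
  have "{I \<in> indeps M. I \<subseteq> X} \<subseteq> Pow (ground M)" using X by blast
  then show "finite (card ` {I \<in> indeps M. I \<subseteq> X})"
    using finite_ground by (meson finite_Pow_iff finite_imageI finite_subset)
next
  fix k assume "k \<in> card ` {I \<in> indeps M. I \<subseteq> X}"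
  then obtain I where I: "k = card I" "I \<in> indeps M" "I \<subseteq> X" by blast
  have "finite I" using I X finite_ground by (meson finite_subset)
  then have "card I = (\<Sum>B\<in>P. card (I \<inter> B))"
    using I X Union_blocks finite_blocks disjoint_blocks by (intro card_eq_sum_blocks) auto
  also have "\<dots> \<le> (\<Sum>B\<in>P. min (card (X \<inter> B)) (r B))"
  proof (rule sum_mono)
    fix B assume B: "B \<in> P"
    have "card (I \<inter> B) \<le> card (X \<inter> B)" using I finite_block[OF B] by (intro card_mono) auto
    then show "card (I \<inter> B) \<le> min (card (X \<inter> B)) (r B)"
      using I B by (auto simp: indeps block_sets_def)
  qed
  finally show "k \<le> (\<Sum>B\<in>P. min (card (X \<inter> B)) (r B))" using I by simp
next
  have "\<exists>J. J \<subseteq> X \<inter> B \<and> card J = min (card (X \<inter> B)) (r B)" for B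
    by (metis min.cobounded1 obtain_subset_with_card_n)
  then obtain J where J: "\<And>B. J B \<subseteq> X \<inter> B" "\<And>B. card (J B) = min (card (X \<inter> B)) (r B)"
    by metis
  let ?I = "\<Union>B\<in>P. J B"
  have IB: "?I \<inter> B = J B" if B: "B \<in> P" for B
  proof -
    have "J C \<inter> B = {}" if "C \<in> P" "C \<noteq> B" for C
    proof -
      have "C \<inter> B = {}" using that B disjoint_blocks by (auto simp: disjoint_def)
      then show ?thesis using J(1)[of C] by blast
    qed
    then show ?thesis using B J(1)[of B] by blast
  qed
  have IX: "?I \<subseteq> X" using J(1) by blast
  moreover have "?I \<in> indeps M"
    using IX X Union_blocks IB J(2) by (auto simp: indeps block_sets_def)
  moreover have "card ?I = (\<Sum>B\<in>P. min (card (X \<inter> B)) (r B))"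
  proof -
    have "card ?I = (\<Sum>B\<in>P. card (?I \<inter> B))"
      using IX X Union_blocks finite_ground finite_blocks disjoint_blocks
      by (intro card_eq_sum_blocks) (auto intro: finite_subset)
    also have "\<dots> = (\<Sum>B\<in>P. min (card (X \<inter> B)) (r B))"
      by (intro sum.cong refl) (simp only: IB J(2))
    finally show ?thesis .
  qed
  ultimately show "(\<Sum>B\<in>P. min (card (X \<inter> B)) (r B)) \<in> card ` {I \<in> indeps M. I \<subseteq> X}"
    by (metis (mono_tags, lifting) imageI mem_Collect_eq)
qed

text \<open>Connectivity is a sum of nonnegative block contributions, so that of \<open>B\<close>
  alone is a lower bound. As \<open>X\<close> has exactly \<open>r B\<close> elements in
  \<open>B\<close>, it equals \<open>r B + min (card B - r B) (r B) - r B\<close>.\<close>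

lemma connectivity_ge:
  assumes X: "X \<subseteq> ground M" and B: "B \<in> P" "card (X \<inter> B) = r B"
  shows "int (min (r B) (card B - r B)) \<le> connectivity M X"
proof -
  \<comment> \<open>The contribution of block \<open>C\<close>; it is nonnegative because truncation
    at \<open>r C\<close> is subadditive.\<close>
  define g where "g C = int (min (card (X \<inter> C)) (r C)) + int (min (card ((ground M - X) \<inter> C)) (r C))
    - int (min (card (ground M \<inter> C)) (r C))" for C
  have GC: "ground M \<inter> C = C" "card C = card (X \<inter> C) + card ((ground M - X) \<inter> C)"
    if C: "C \<in> P" for C
  proof -
    show "ground M \<inter> C = C" using Union_blocks C by blast
    then have "(ground M - X) \<inter> C = C - X" by blast
    then show "card C = card (X \<inter> C) + card ((ground M - X) \<inter> C)"
      using card_Int_Diff[OF finite_block[OF C], of X] by (simp add: Int_commute)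
  qed
  have "connectivity M X = (\<Sum>C\<in>P. g C)"
    using X by (simp add: connectivity_def rank_eq g_def sum.distrib sum_subtractf)
  moreover have "g B \<le> (\<Sum>C\<in>P. g C)"
    using B(1) finite_blocks GC by (intro member_le_sum) (auto simp: g_def)
  moreover have "int (min (r B) (card B - r B)) \<le> g B"
    using GC[OF B(1)] B(2) by (auto simp: g_def)
  ultimately show ?thesis by simp
qed

text \<open>A discrete intermediate value argument: along the prefixes the count of elements of
  \<open>B\<close> rises from 0 to \<open>card B\<close> in steps of at most one, so it takes the
  value \<open>r B\<close>, where \<open>connectivity_ge\<close> applies.\<close>

lemma order_pathwidth_ge:
  assumes es: "es \<in> permutations_of_set (ground M)" and B: "B \<in> P"
  shows "int (min (r B) (card B - r B)) \<le> order_pathwidth M es"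
\<comment> \<open>For rank 0 the prefix found could be the empty one, which the maximum does not
  range over; the bound is then trivially 0.\<close>
proof (cases "r B = 0")
  case True
  then show ?thesis by (simp add: order_pathwidth_def)
next
  case False
  define h where "h i = card (set (take i es) \<inter> B)" for i
  have set_es: "set es = ground M" "distinct es" using es by (auto simp: permutations_of_set_def)
  have h0: "h 0 = 0" by (simp add: h_def)
  have hn: "h (length es) = card B"
    using set_es B Union_blocks by (auto simp: h_def intro: arg_cong[where f = card])
  have hS: "h (Suc i) \<le> Suc (h i)" if "i < length es" for i
    using that by (auto simp: h_def take_Suc_conv_app_nth Int_insert_left card_insert_if)
  have "\<exists>i\<le>length es. h i = r B"
  proof -
    have "\<exists>i\<le>l. h i = c" if "l \<le> length es" "c \<le> h l" for l c
      using that
    proof (induction l)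
      case 0
      then show ?case using h0 by auto
    next
      case (Suc l)
      show ?case
      proof (cases "c \<le> h l")
        case True
        then show ?thesis using Suc by (meson Suc_leD le_SucI)
      next
        case False
        then have "h (Suc l) = c" using hS[of l] Suc.prems by simp
        then show ?thesis by blast
      qed
    qed
    then show ?thesis using hn rank_le_card[OF B] by (metis order_refl)
  qed
  then obtain i where i: "i \<le> length es" "h i = r B" by blast
  then have "i \<in> {1..length es}" using False h0 by (cases i) auto
  moreover have "int (min (r B) (card B - r B)) \<le> connectivity M (set (take i es))"
    using set_es i B by (intro connectivity_ge) (auto simp: h_def dest: in_set_takeD)
  ultimately show ?thesis unfolding order_pathwidth_def
    by (subst Max_ge_iff) auto
qed

lemma pathwidth_ge:
  assumes "\<And>es. es \<in> permutations_of_set (ground M) \<Longrightarrow> k \<le> order_pathwidth M es"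
  shows "k \<le> pathwidth M"
  unfolding pathwidth_def
proof (rule Min.boundedI)
  show "finite (order_pathwidth M ` permutations_of_set (ground M))" by simp
  show "order_pathwidth M ` permutations_of_set (ground M) \<noteq> {}"
    using finite_ground by (simp add: permutations_of_set_empty_iff)
qed (use assms in blast)

text \<open>Each level belongs to one block \<open>B\<close>, and
  \<open>min (r B) (card B - r B)\<close> both bounds its width up to one and is a lower bound for
  the pathwidth.\<close>

lemma width_le_pathwidth:
  assumes D: "sound z es (\<lambda>p. path_set es p \<in> block_sets P R) D" "reduced z D"
    and R: "R = (\<lambda>B. {..r B}) \<or> R = (\<lambda>B. {r B})"
    and es: "es \<in> permutations_of_set (ground M)"
    and contiguous: "\<forall>i<length es. \<forall>C\<in>P. es ! i \<notin> C \<longrightarrow>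
      C \<inter> set (take i es) = {} \<or> C \<inter> set (drop i es) = {}"
  shows "int (width es D) \<le> pathwidth M + 1"
proof -
  have set_es: "set es = ground M" "distinct es" using es by (auto simp: permutations_of_set_def)
  have "int (width_at es D i) \<le> pathwidth M + 1" if i: "i < length es" for i
  proof -
    obtain B where B: "B \<in> P" "es ! i \<in> B" using i set_es Union_blocks nth_mem by blast
    have "width_at es D i \<le> min (r B) (card B - r B) + 1"
    proof (rule width_at_block_sets[where r = r and B = B, OF D _ set_es(2) i _ B(1) rank_le_card[OF B(1)]])
      show "R B = {..r B} \<or> R B = {r B}" using R by auto
      show "B \<subseteq> set es" using set_es Union_blocks B by blast
      show "C \<inter> set (take i es) = {} \<or> C \<inter> set (drop i es) = {}" if "C \<in> P" "C \<noteq> B" for C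
      proof -
        have "es ! i \<notin> C" using that B disjoint_blocks by (auto simp: disjoint_def)
        then show ?thesis using contiguous i that by blast
      qed
    qed
    moreover have "int (min (r B) (card B - r B)) \<le> pathwidth M"
      using order_pathwidth_ge B by (intro pathwidth_ge)
    ultimately show ?thesis by linarith
  qed
  \<comment> \<open>This handles the value 0 inserted into the maximum that defines
    \<open>width\<close>.\<close>
  moreover have "0 \<le> pathwidth M"
    by (rule pathwidth_ge) (simp add: order_pathwidth_def)
  moreover have "width es D \<in> insert 0 (width_at es D ` {..<length es})"
    unfolding width_def by (rule Max_in) auto
  ultimately show ?thesis by auto
qed

end

theorem theorem4p13:
  fixes M :: "'a matroid"
  assumes "partition_matroid M"
  shows "\<exists>es \<in> permutations_of_set (ground M).
    (\<forall>D. is_BDD es (indeps M) D \<longrightarrow> int (width es D) \<le> pathwidth M + 1) \<and>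
    (\<forall>D. is_BDD es (bases M) D \<longrightarrow> int (width es D) \<le> pathwidth M + 1) \<and>
    (\<forall>D. is_ZDD es (indeps M) D \<longrightarrow> int (width es D) \<le> pathwidth M + 1) \<and>
    (\<forall>D. is_ZDD es (bases M) D \<longrightarrow> int (width es D) \<le> pathwidth M + 1)"
proof -
  obtain P r where "block_matroid M P r"
    using partition_matroid_blocks[OF assms] unfolding block_matroid_def by blast
  then interpret block_matroid M P r .
  \<comment> \<open>The order depends only on the partition, so the same one serves both families
    and both kinds of diagram.\<close>
  obtain es where es: "es \<in> permutations_of_set (ground M)"
    and contiguous: "\<forall>i<length es. \<forall>C\<in>P. es ! i \<notin> C \<longrightarrow>
      C \<inter> set (take i es) = {} \<or> C \<inter> set (drop i es) = {}"
    using ex_contiguous_order[OF finite_blocks disjoint_blocks] finite_ground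
    unfolding Union_blocks by blast
  have dist: "distinct es" using es by (simp add: permutations_of_set_def)
  have bound: "int (width es D) \<le> pathwidth M + 1"
    if dd: "is_BDD es S D \<or> is_ZDD es S D" and S: "S = indeps M \<or> S = bases M" for S D
  proof -
    obtain R where R: "S = block_sets P R" "R = (\<lambda>B. {..r B}) \<or> R = (\<lambda>B. {r B})"
      using S indeps bases_eq by blast
    obtain z where "sound z es (\<lambda>p. path_set es p \<in> block_sets P R) D" "reduced z D"
      using dd is_BDD_sound_reduced[OF _ dist] is_ZDD_sound_reduced[OF _ dist]
      unfolding R(1) by blast
    then show ?thesis using R(2) es contiguous by (rule width_le_pathwidth)
  qed
  show ?thesis using es bound by blast
qed

end
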